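(* Let $f:\mathbb{R}^n\to\mathbb{R}$ be a convex function. Then for every measurable set $A\subset\mathbb{R}^n$ of finite Lebesgue measure and for every $\varepsilon>0$, there exists a convex function $g\in C^{1,1}(\mathbb{R}^n)$ such that $$|\{x\in A:\ f(x)\ne g(x)\}|<\varepsilon.$$
   Context: $|E|$ denotes the Lebesgue measure of $E\subset\mathbb{R}^n$. $g\in C^{1,1}(\mathbb{R}^n)$ means that $g\in C^1(\mathbb{R}^n)$ and its derivative $Dg$ is (globally) Lipschitz continuous on $\mathbb{R}^n$. *)

theory Defs
  imports "HOL-Analysis.Analysis"
begin

definition C11 :: "('a::real_normed_vector \<Rightarrow> 'b::real_normed_vector) \<Rightarrow> bool" where
  "C11 g \<longleftrightarrow> (\<exists>Dg :: 'a \<Rightarrow> 'a \<Rightarrow>\<^sub>L 'b.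
      (\<forall>x. (g has_derivative blinfun_apply (Dg x)) (at x)) \<and>
      continuous_on UNIV Dg \<and>
      (\<exists>L. L-lipschitz_on UNIV Dg))"

end

theory Submission
  imports Defs
begin

text \<open>
  On a ball of large radius \<open>R\<close>, \<open>f\<close> coincides with a globally \<open>L\<close>-Lipschitz convex function \<open>F\<close>. Let
  \<open>c y = max\<^sub>x (F x - M/2 |x - y|\<^sup>2)\<close>, attained at \<open>X y\<close>, and
  \<open>g z = min\<^sub>y (c y + M/2 |z - y|\<^sup>2)\<close> (Lasry-Lions regularization). Both are convex, and \<open>g\<close>
  is also semiconcave, hence \<open>C\<^sup>1\<^sup>,\<^sup>1\<close>; moreover \<open>g = F\<close> on the range of \<open>X\<close>. Since \<open>M (X y - y)\<close>
  is a subgradient of \<open>c\<close>, the map \<open>X\<close> is expanding, so the Vitali covering theorem shows that it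
  does not decrease measure; and \<open>|X y - y| \<le> 2L/M\<close>. Thus \<open>{F = g}\<close> fills the ball of radius
  \<open>R + 2L/M\<close> up to the volume of a thin shell, which vanishes as \<open>M\<close> tends to infinity.
\<close>

section \<open>Nonexpansive maps and Lebesgue measure\<close>

text \<open>Countable subadditivity handles the possibly overlapping \<open>X i\<close>;
  disjointness turns the sum over the \<open>Y i\<close> back into a measure.\<close>

lemma emeasure_UN_le_disjoint:
  assumes I: "countable I" and X: "\<And>i. i \<in> I \<Longrightarrow> X i \<in> sets M" and Y: "\<And>i. i \<in> I \<Longrightarrow> Y i \<in> sets M"
    and le: "\<And>i. i \<in> I \<Longrightarrow> emeasure M (X i) \<le> emeasure M (Y i)"
    and disj: "disjoint_family_on Y I"
  shows "emeasure M (\<Union>i\<in>I. X i) \<le> emeasure M (\<Union>i\<in>I. Y i)"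
proof -
  \<comment> \<open>Reindexing by natural numbers, padded with empty sets, treats finite and
    infinite \<open>I\<close> alike.\<close>
  define ext where "ext Z n = (if n \<in> to_nat_on I ` I then Z (from_nat_into I n) else {})"
    for Z :: "'a \<Rightarrow> 'b set" and n
  have UN: "(\<Union>n. ext Z n) = (\<Union>i\<in>I. Z i)" for Z
    using I by (fastforce simp: ext_def split: if_splits)
  have mem: "from_nat_into I n \<in> I" if "n \<in> to_nat_on I ` I" for n
    using that I by auto
  have "emeasure M (\<Union>n. ext X n) \<le> (\<Sum>n. emeasure M (ext X n))"
    using X mem by (intro emeasure_subadditive_countably) (auto simp: ext_def)
  also have "\<dots> \<le> (\<Sum>n. emeasure M (ext Y n))"
    using le mem by (intro suminf_le) (auto simp: ext_def)
  also have "\<dots> = emeasure M (\<Union>n. ext Y n)"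
  proof (rule suminf_emeasure)
    show "disjoint_family (ext Y)"
      unfolding disjoint_family_on_def
    proof (intro ballI impI)
      fix m n :: nat assume "m \<noteq> n"
      show "ext Y m \<inter> ext Y n = {}"
      proof (cases "m \<in> to_nat_on I ` I \<and> n \<in> to_nat_on I ` I")
        case True
        then have "from_nat_into I m \<noteq> from_nat_into I n" using \<open>m \<noteq> n\<close> I by auto
        then show ?thesis
          using True mem disj by (simp add: ext_def disjoint_family_on_def)
      qed (auto simp: ext_def)
    qed
  qed (use Y mem in \<open>auto simp: ext_def\<close>)
  finally show ?thesis unfolding UN .
qed

text \<open>Up to a null set, disjoint balls inside an open set barely larger than \<open>G\<close>
  cover \<open>S\<close>. The part of \<open>S\<close> in each ball is sent into a ball of the same
  radius, and null sets go to null sets. \<open>G\<close> stands in for the outer measure of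
  \<open>S\<close>, which may be non-measurable.\<close>

lemma emeasure_le_of_nonexpansive_image:
  fixes T :: "'a::euclidean_space \<Rightarrow> 'a"
  assumes lip: "1-lipschitz_on S T" and G: "G \<in> sets lebesgue" "S \<subseteq> G"
    and C: "C \<subseteq> T ` S"
  shows "emeasure lebesgue C \<le> emeasure lebesgue G"
proof (rule ennreal_le_epsilon)
  fix e :: real assume e: "e > 0"
  obtain U where U: "open U" "G \<subseteq> U" "U - G \<in> lmeasurable" "emeasure lebesgue (U - G) < ennreal e"
    using sets_lebesgue_outer_open[OF G(1) e] by blast
  \<comment> \<open>Centres are kept in \<open>S\<close>, where \<open>T\<close> is nonexpansive;
    staying inside \<open>U\<close> bounds the total volume.\<close>
  define K where "K = {i. fst i \<in> S \<and> 0 < snd i \<and> ball (fst i) (snd i) \<subseteq> U}"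
  have "\<exists>i. i \<in> K \<and> x \<in> ball (fst i) (snd i) \<and> snd i < d" if x: "x \<in> S" "d > 0" for x d
  proof -
    obtain r where r: "r > 0" "ball x r \<subseteq> U"
      using U x G by (meson openE subsetD)
    have "ball x (min r (d/2)) \<subseteq> U" using r by auto
    then show ?thesis
      using r x by (intro exI[of _ "(x, min r (d/2))"]) (auto simp: K_def)
  qed
  then obtain D where D: "countable D" "D \<subseteq> K"
     "pairwise (\<lambda>i j. disjnt (ball (fst i) (snd i)) (ball (fst j) (snd j))) D"
     "negligible (S - (\<Union>i \<in> D. ball (fst i) (snd i)))"
    by (rule Vitali_covering_theorem_balls[of S K fst snd])
  define N where "N = S - (\<Union>i \<in> D. ball (fst i) (snd i))"
  have "negligible (T ` N)"
  proof (rule negligible_locally_Lipschitz_image)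
    show "negligible N" using D by (simp add: N_def)
    show "\<exists>V B. open V \<and> x \<in> V \<and> (\<forall>y \<in> N \<inter> V. norm (T y - T x) \<le> B * norm (y - x))" if "x \<in> N" for x
      using lipschitz_onD[OF lip] that
      by (intro exI[of _ UNIV] exI[of _ 1]) (auto simp: N_def dist_norm)
  qed simp
  then have N: "T ` N \<in> null_sets lebesgue"
    by (simp add: negligible_iff_null_sets)
  have sub: "C \<subseteq> T ` N \<union> (\<Union>i\<in>D. ball (T (fst i)) (snd i))"
  proof
    fix y assume "y \<in> C"
    then obtain x where x: "x \<in> S" "y = T x" using C by auto
    show "y \<in> T ` N \<union> (\<Union>i\<in>D. ball (T (fst i)) (snd i))"
    proof (cases "x \<in> N")
      case False
      then obtain i where i: "i \<in> D" "x \<in> ball (fst i) (snd i)" using x by (auto simp: N_def)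
      then have "dist (T (fst i)) (T x) \<le> dist (fst i) x"
        using lipschitz_onD[OF lip, of "fst i" x] x D(2) by (auto simp: K_def)
      then show ?thesis using i x by force
    qed (use x in auto)
  qed
  have "emeasure lebesgue C \<le> emeasure lebesgue (T ` N \<union> (\<Union>i\<in>D. ball (T (fst i)) (snd i)))"
    using N D(1) by (intro emeasure_mono[OF sub] sets.Un sets.countable_UN') auto
  also have "\<dots> = emeasure lebesgue (\<Union>i\<in>D. ball (T (fst i)) (snd i))"
    using N D(1) by (subst Un_commute, intro emeasure_Un_null_set sets.countable_UN') auto
  \<comment> \<open>Paired balls have equal radii, hence equal volume; the moved balls may overlap,
    the original ones do not.\<close>
  also have "\<dots> \<le> emeasure lebesgue (\<Union>i\<in>D. ball (fst i) (snd i))"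
    using D by (intro emeasure_UN_le_disjoint)
      (auto simp: K_def emeasure_ball less_imp_le disjoint_family_on_def pairwise_def disjnt_def)
  also have "\<dots> \<le> emeasure lebesgue U"
    using U D by (intro emeasure_mono) (auto simp: K_def)
  also have "\<dots> \<le> emeasure lebesgue (G \<union> (U - G))"
    using U G by (intro emeasure_mono) auto
  also have "\<dots> \<le> emeasure lebesgue G + emeasure lebesgue (U - G)"
    using G U by (intro emeasure_subadditive) auto
  also have "\<dots> \<le> emeasure lebesgue G + ennreal e"
    using U by (intro add_left_mono) auto
  finally show "emeasure lebesgue C \<le> emeasure lebesgue G + ennreal e" .
qed

section \<open>Infimal convolution and support of convex functions\<close>

text \<open>The sum \<open>c y + k (z - y)\<close> is jointly convex in \<open>y\<close> and
  \<open>z\<close>, and minimizing over one variable preserves convexity.\<close>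

lemma convex_on_infimal_convolution:
  fixes c k :: "'a::real_vector \<Rightarrow> real"
  assumes c: "convex_on UNIV c" and k: "convex_on UNIV k"
    and bdd: "\<And>z. bdd_below (range (\<lambda>y. c y + k (z - y)))"
  shows "convex_on UNIV (\<lambda>z. INF y. c y + k (z - y))"
proof (rule convex_onI)
  fix t :: real and a b :: 'a assume t: "0 < t" "t < 1"
  define g where "g = (\<lambda>z. INF y. c y + k (z - y))"
  show "g ((1 - t) *\<^sub>R a + t *\<^sub>R b) \<le> (1 - t) * g a + t * g b"
  proof (rule field_le_epsilon)
    fix e :: real assume "e > 0"
    \<comment> \<open>Near-minimizers are used because the infimum may fail to be attained.\<close>
    then obtain y1 y2 where y: "c y1 + k (a - y1) < g a + e" "c y2 + k (b - y2) < g b + e"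
      using bdd cINF_less_iff[of UNIV "\<lambda>y. c y + k (a - y)" "g a + e"]
        cINF_less_iff[of UNIV "\<lambda>y. c y + k (b - y)" "g b + e"] by (auto simp: g_def)
    let ?y = "(1 - t) *\<^sub>R y1 + t *\<^sub>R y2"
    have "g ((1 - t) *\<^sub>R a + t *\<^sub>R b) \<le> c ?y + k ((1 - t) *\<^sub>R a + t *\<^sub>R b - ?y)"
      unfolding g_def by (rule cINF_lower[OF bdd]) simp
    also have "(1 - t) *\<^sub>R a + t *\<^sub>R b - ?y = (1 - t) *\<^sub>R (a - y1) + t *\<^sub>R (b - y2)"
      by (simp add: algebra_simps)
    also have "c ?y + k \<dots> \<le> ((1 - t) * c y1 + t * c y2) + ((1 - t) * k (a - y1) + t * k (b - y2))"
      using t by (intro add_mono convex_onD[OF c] convex_onD[OF k]) auto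
    also have "\<dots> = (1 - t) * (c y1 + k (a - y1)) + t * (c y2 + k (b - y2))"
      by (simp add: algebra_simps)
    also have "\<dots> \<le> (1 - t) * (g a + e) + t * (g b + e)"
      using t y by (intro add_mono[OF mult_left_mono mult_left_mono]) auto
    finally show "g ((1 - t) *\<^sub>R a + t *\<^sub>R b) \<le> (1 - t) * g a + t * g b + e"
      by (simp add: algebra_simps)
  qed
qed simp

text \<open>If the affine bound fails at \<open>z\<close> by \<open>d\<close>, convexity makes it
  fail by at least \<open>t * d\<close> at the fraction \<open>t\<close> of the segment from
  \<open>x\<close> to \<open>z\<close>, while the minorant allows only an error quadratic in
  \<open>t\<close>.\<close>

lemma convex_on_affine_minorant:
  fixes c :: "'a::real_inner \<Rightarrow> real"
  assumes c: "convex_on UNIV c"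
    and minorant: "\<And>z. c x + p \<bullet> (z - x) - K * (norm (z - x))\<^sup>2 \<le> c z"
  shows "c x + p \<bullet> (z - x) \<le> c z"
proof (rule ccontr)
  define d where "d = c x + p \<bullet> (z - x) - c z"
  define B where "B = \<bar>K * (norm (z - x))\<^sup>2\<bar>"
  assume "\<not> ?thesis"
  then have d: "d > 0" by (simp add: d_def)
  \<comment> \<open>Small enough that \<open>t * B < d\<close>, which contradicts the comparison
    along the segment.\<close>
  define t where "t = d / (2 * (B + d))"
  have B: "B \<ge> 0" by (simp add: B_def)
  have t: "0 < t" "t < 1" using d B by (auto simp: t_def field_simps)
  let ?w = "(1 - t) *\<^sub>R x + t *\<^sub>R z"
  have w: "?w - x = t *\<^sub>R (z - x)" by (simp add: algebra_simps)
  have "c x + t * (p \<bullet> (z - x)) - K * (t\<^sup>2 * (norm (z - x))\<^sup>2) \<le> c ?w"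
    using minorant[of ?w] t unfolding w by (simp add: power_mult_distrib)
  also have "c ?w \<le> (1 - t) * c x + t * c z"
    using t by (intro convex_onD[OF c]) auto
  finally have "t * d \<le> t * (t * (K * (norm (z - x))\<^sup>2))"
    by (simp add: d_def algebra_simps power2_eq_square)
  then have "d \<le> t * (K * (norm (z - x))\<^sup>2)" using t by simp
  also have "\<dots> \<le> t * B" using t by (intro mult_left_mono) (auto simp: B_def)
  also have "\<dots> < d" using d B by (simp add: t_def field_simps add_nonneg_pos)
  finally show False by simp
qed

section \<open>Regularity from two-sided quadratic bounds\<close>

text \<open>Squeezed between a plane and a paraboloid touching it at \<open>x\<close>,
  \<open>g\<close> has gradient \<open>P x\<close> there; comparing the bounds based at two points
  makes \<open>P\<close> Lipschitz.\<close>

lemma C11_quadratic_bounds: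
  fixes g :: "'a::euclidean_space \<Rightarrow> real"
  assumes lo: "\<And>x z. g x + P x \<bullet> (z - x) \<le> g z"
    and up: "\<And>x z. g z \<le> g x + P x \<bullet> (z - x) + K * (norm (z - x))\<^sup>2"
    and K: "K \<ge> 0"
  shows "C11 g"
proof -
  have P: "norm (P x - P y) \<le> 2 * K * norm (x - y)" for x y
  proof (cases "x = y \<or> P x = P y")
    case False
    let ?u = "P x - P y"
    \<comment> \<open>Alignment with \<open>?u\<close> turns the inner product into a product of
      norms; the length \<open>norm (x - y)\<close> makes both quadratic errors equal, whence the
      constant \<open>2 * K\<close>.\<close>
    define v where "v = (norm (x - y) / norm ?u) *\<^sub>R ?u"
    have v: "norm v = norm (x - y)" and uv: "?u \<bullet> v = norm (x - y) * norm ?u"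
      using False by (auto simp: v_def power2_norm_eq_inner[symmetric] power2_eq_square)
    have "?u \<bullet> v \<le> K * (norm (y - x))\<^sup>2 + K * (norm v)\<^sup>2"
      using lo[of x "y + v"] up[of "y + v" y] up[of y x] by (simp add: inner_simps)
    then have "norm (x - y) * norm ?u \<le> norm (x - y) * (2 * K * norm (x - y))"
      unfolding uv v by (simp add: norm_minus_commute power2_eq_square mult_ac)
    then show ?thesis using False by simp
  qed (use K in auto)
  define Dg where "Dg x = blinfun_inner_right (P x)" for x
  have deriv: "(g has_derivative blinfun_apply (Dg x)) (at x)" for x
    unfolding has_derivative_at2
  proof (intro conjI)
    show "bounded_linear (blinfun_apply (Dg x))" by (rule blinfun.bounded_linear_right)
    have "((\<lambda>y. K * norm (y - x)) \<longlongrightarrow> K * norm (x - x)) (at x)"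
      by (intro tendsto_intros)
    then have lim: "((\<lambda>y. K * norm (y - x)) \<longlongrightarrow> 0) (at x)" by simp
    show "((\<lambda>y. (1 / norm (y - x)) *\<^sub>R (g y - (g x + blinfun_apply (Dg x) (y - x)))) \<longlongrightarrow> 0) (at x)"
    proof (rule Lim_null_comparison[OF _ lim], rule always_eventually, rule allI)
      fix y
      have "\<bar>g y - (g x + P x \<bullet> (y - x))\<bar> \<le> K * (norm (y - x))\<^sup>2"
        using lo[of x y] up[of y x] by simp
      then show "norm ((1 / norm (y - x)) *\<^sub>R (g y - (g x + blinfun_apply (Dg x) (y - x)))) \<le> K * norm (y - x)"
        by (cases "y = x") (auto simp: Dg_def field_simps power2_eq_square)
    qed
  qed
  have lip: "(2 * K)-lipschitz_on UNIV Dg"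
  proof (rule lipschitz_onI)
    fix x y
    have "norm (Dg x - Dg y) \<le> norm (P x - P y)"
      by (rule norm_blinfun_bound)
        (auto simp: Dg_def blinfun.diff_left inner_diff_left[symmetric] intro: Cauchy_Schwarz_ineq2)
    with P[of x y] show "dist (Dg x) (Dg y) \<le> 2 * K * dist x y"
      by (simp add: dist_norm)
  qed (use K in simp)
  show ?thesis
    unfolding C11_def using deriv lip lipschitz_on_continuous_on[OF lip] by blast
qed

section \<open>Lasry-Lions regularization\<close>

text \<open>Beyond distance \<open>2 * L / M\<close> from \<open>y\<close> the penalty beats the
  Lipschitz growth of \<open>h\<close>, so a maximum over that compact ball is global. Stated for
  any Lipschitz \<open>h\<close>, it serves both \<open>F\<close> and \<open>- c\<close>
  below.\<close>

lemma lipschitz_minus_quadratic_attains_max: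
  fixes h :: "'a::euclidean_space \<Rightarrow> real"
  assumes h: "L-lipschitz_on UNIV h" and M: "M > 0"
  shows "\<exists>x. \<forall>z. h z - M / 2 * (norm (z - y))\<^sup>2 \<le> h x - M / 2 * (norm (x - y))\<^sup>2"
proof -
  let ?q = "\<lambda>z. h z - M / 2 * (norm (z - y))\<^sup>2"
  have L: "L \<ge> 0" using h by (rule lipschitz_on_nonneg)
  have "continuous_on (cball y (2 * L / M)) ?q"
    by (intro continuous_intros continuous_on_subset[OF lipschitz_on_continuous_on[OF h]]) auto
  moreover have y: "y \<in> cball y (2 * L / M)" using L M by simp
  moreover have "compact (cball y (2 * L / M))" by simp
  ultimately obtain x where x: "\<And>z. z \<in> cball y (2 * L / M) \<Longrightarrow> ?q z \<le> ?q x"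
    using continuous_attains_sup[of "cball y (2 * L / M)" ?q] by blast
  have "?q z \<le> ?q x" for z
  proof (cases "z \<in> cball y (2 * L / M)")
    case False
    then have "2 * L \<le> M * norm (z - y)"
      using M by (simp add: dist_norm norm_minus_commute field_simps)
    then have "2 * L * norm (z - y) \<le> M * norm (z - y) * norm (z - y)"
      by (rule mult_right_mono) simp
    moreover have "h z - h y \<le> L * norm (z - y)"
      using lipschitz_onD[OF h, of z y] by (simp add: dist_norm)
    ultimately have "?q z \<le> ?q y" by (simp add: power2_eq_square)
    then show ?thesis using x[OF y] by simp
  qed (rule x)
  then show ?thesis by blast
qed

text \<open>The Jensen gap of the squared norm is exactly
  \<open>t * (1 - t) * (norm (a - b))\<^sup>2\<close>.\<close>

lemma convex_on_norm_power2:
  assumes "K \<ge> 0"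
  shows "convex_on UNIV (\<lambda>x::'a::real_inner. K * (norm x)\<^sup>2)"
proof (rule convex_onI)
  fix t :: real and a b :: 'a assume "0 < t" "t < 1"
  then have "0 \<le> K * (t * (1 - t) * (norm (a - b))\<^sup>2)" using assms by simp
  also have "\<dots> = (1 - t) * (K * (norm a)\<^sup>2) + t * (K * (norm b)\<^sup>2)
      - K * (norm ((1 - t) *\<^sub>R a + t *\<^sub>R b))\<^sup>2"
    unfolding power2_norm_eq_inner by (simp add: inner_simps inner_commute algebra_simps)
  finally show "K * (norm ((1 - t) *\<^sub>R a + t *\<^sub>R b))\<^sup>2 \<le> (1 - t) * (K * (norm a)\<^sup>2) + t * (K * (norm b)\<^sup>2)"
    by simp
qed simp

text \<open>\<open>X\<close> is returned along with \<open>g\<close> because the volume of the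
  coincidence set is later bounded below through it.\<close>

lemma lasry_lions_regularization:
  fixes F :: "'a::euclidean_space \<Rightarrow> real"
  assumes F: "convex_on UNIV F" and lip: "L-lipschitz_on UNIV F" and M: "M > 0"
  obtains g X where "convex_on UNIV g" "C11 g" "\<And>y. g (X y) = F (X y)"
    "\<And>y. norm (X y - y) \<le> 2 * L / M" "\<And>a b. norm (a - b) \<le> norm (X a - X b)"
proof -
  obtain X where X: "\<And>y z. F z - M / 2 * (norm (z - y))\<^sup>2 \<le> F (X y) - M / 2 * (norm (X y - y))\<^sup>2"
    using lipschitz_minus_quadratic_attains_max[OF lip M] by metis
  define c where "c y = F (X y) - M / 2 * (norm (X y - y))\<^sup>2" for y
  have cF: "F z - M / 2 * (norm (z - y))\<^sup>2 \<le> c y" for y z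
    using X by (simp add: c_def)
  have c_shift: "F (y + w) - M / 2 * (norm w)\<^sup>2 \<le> c y" for y w
    using cF[of "y + w" y] by simp
  have c_eq: "c y = F (y + (X y - y)) - M / 2 * (norm (X y - y))\<^sup>2" for y
    by (simp add: c_def)
  \<comment> \<open>\<open>c\<close> is a supremum over shifts \<open>w\<close> of the convex
    functions \<open>F (y + w) - M / 2 * (norm w)\<^sup>2\<close> of \<open>y\<close>; the shift
    optimal at \<open>?y\<close> serves at both endpoints.\<close>
  have c_convex: "convex_on UNIV c"
  proof (rule convex_onI)
    fix t :: real and a b :: 'a assume t: "0 < t" "t < 1"
    let ?y = "(1 - t) *\<^sub>R a + t *\<^sub>R b"
    let ?w = "X ?y - ?y"
    have "F (?y + ?w) = F ((1 - t) *\<^sub>R (a + ?w) + t *\<^sub>R (b + ?w))"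
      by (rule arg_cong[of _ _ F]) (simp add: algebra_simps)
    also have "\<dots> \<le> (1 - t) * F (a + ?w) + t * F (b + ?w)"
      using t by (intro convex_onD[OF F]) auto
    finally have "c ?y \<le> (1 - t) * (F (a + ?w) - M / 2 * (norm ?w)\<^sup>2)
        + t * (F (b + ?w) - M / 2 * (norm ?w)\<^sup>2)"
      unfolding c_eq[of ?y] left_diff_distrib right_diff_distrib by simp
    also have "\<dots> \<le> (1 - t) * c a + t * c b"
      using t c_shift by (intro add_mono mult_left_mono) auto
    finally show "c ?y \<le> (1 - t) * c a + t * c b" .
  qed simp
  \<comment> \<open>Reusing at \<open>b\<close> the optimal shift of \<open>a\<close> passes the
    Lipschitz constant of \<open>F\<close> on to \<open>c\<close>, so that the infimum defining
    \<open>g\<close> is attained.\<close>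
  have c_diff: "c a - c b \<le> L * norm (a - b)" for a b
  proof -
    have "F (a + (X a - a)) - F (b + (X a - a)) \<le> L * norm (a - b)"
      using lipschitz_onD[OF lip, of "a + (X a - a)" "b + (X a - a)"] by (simp add: dist_norm)
    then show ?thesis using c_shift[of b "X a - a"] c_eq[of a] by simp
  qed
  have c_lip: "L-lipschitz_on UNIV (\<lambda>y. - c y)"
  proof (rule lipschitz_onI)
    fix a b show "dist (- c a) (- c b) \<le> L * dist a b"
      using c_diff[of a b] c_diff[of b a] by (simp add: dist_norm norm_minus_commute)
  qed (rule lipschitz_on_nonneg[OF lip])
  obtain Y where "\<And>z y. - c y - M / 2 * (norm (y - z))\<^sup>2 \<le> - c (Y z) - M / 2 * (norm (Y z - z))\<^sup>2"
    using lipschitz_minus_quadratic_attains_max[OF c_lip M] by metis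
  then have Y: "c (Y z) + M / 2 * (norm (z - Y z))\<^sup>2 \<le> c y + M / 2 * (norm (z - y))\<^sup>2" for z y
    by (smt (verit) norm_minus_commute)
  then have bdd: "bdd_below (range (\<lambda>y. c y + M / 2 * (norm (z - y))\<^sup>2))" for z
    by (intro bdd_belowI2)
  define g where "g z = (INF y. c y + M / 2 * (norm (z - y))\<^sup>2)" for z
  have g_le: "g z \<le> c y + M / 2 * (norm (z - y))\<^sup>2" for z y
    unfolding g_def by (rule cINF_lower[OF bdd]) simp
  have g_eq: "g z = c (Y z) + M / 2 * (norm (z - Y z))\<^sup>2" for z
    by (rule antisym[OF g_le]) (use Y in \<open>auto simp: g_def intro: cINF_greatest\<close>)
  have g_convex: "convex_on UNIV g"
    unfolding g_def using M bdd by (intro convex_on_infimal_convolution c_convex convex_on_norm_power2) auto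
  \<comment> \<open>The gradient at \<open>z\<close> of the paraboloid centred at \<open>Y z\<close>
    that touches \<open>g\<close> from above there.\<close>
  define P where "P z = M *\<^sub>R (z - Y z)" for z
  have up: "g z' \<le> g z + P z \<bullet> (z' - z) + M / 2 * (norm (z' - z))\<^sup>2" for z z'
  proof -
    have "M / 2 * (norm (z' - Y z))\<^sup>2 = M / 2 * (norm (z - Y z))\<^sup>2 + P z \<bullet> (z' - z) + M / 2 * (norm (z' - z))\<^sup>2"
      unfolding P_def power2_norm_eq_inner by (simp add: inner_commute algebra_simps)
    then show ?thesis using g_le[of z' "Y z"] g_eq[of z] by linarith
  qed
  \<comment> \<open>Midpoint convexity between \<open>w\<close> and its reflection through
    \<open>z\<close> turns the upper paraboloid at the reflected point into a lower one at
    \<open>w\<close>; convexity then removes the quadratic term.\<close>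
  have lo: "g z + P z \<bullet> (z' - z) \<le> g z'" for z z'
  proof (rule convex_on_affine_minorant[OF g_convex])
    fix w
    have "g ((1 - 1/2) *\<^sub>R w + (1/2) *\<^sub>R (2 *\<^sub>R z - w)) \<le> (1 - 1/2) * g w + (1/2) * g (2 *\<^sub>R z - w)"
      by (rule convex_onD[OF g_convex]) auto
    moreover have "(1 - 1/2) *\<^sub>R w + (1/2) *\<^sub>R (2 *\<^sub>R z - w) = z"
      by (simp add: algebra_simps)
    moreover have reflect: "2 *\<^sub>R z - w - z = z - w"
      by (simp add: scaleR_2)
    have "g (2 *\<^sub>R z - w) \<le> g z + P z \<bullet> (z - w) + M / 2 * (norm (z - w))\<^sup>2"
      using up[of "2 *\<^sub>R z - w" z] unfolding reflect .
    ultimately show "g z + P z \<bullet> (w - z) - M / 2 * (norm (w - z))\<^sup>2 \<le> g w"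
      by (simp add: norm_minus_commute inner_diff_right)
  qed
  have g_C11: "C11 g"
    using M by (intro C11_quadratic_bounds[OF lo up]) auto
  have F_le: "F z \<le> g z" for z
    unfolding g_def using cF by (intro cINF_greatest) (auto simp: algebra_simps)
  \<comment> \<open>The competitor \<open>y\<close> in the infimum gives \<open>g (X y)\<close> at
    most \<open>F (X y)\<close>.\<close>
  have contact: "g (X y) = F (X y)" for y
    using g_le[of "X y" y] F_le[of "X y"] by (simp add: c_def)
  have dist: "norm (X y - y) \<le> 2 * L / M" for y
  proof (cases "X y = y")
    case False
    have "M / 2 * (norm (X y - y))\<^sup>2 \<le> L * norm (X y - y)"
      using X[of y y] lipschitz_onD[OF lip, of "X y" y] by (simp add: dist_norm)
    then show ?thesis
      using False M by (simp add: power2_eq_square field_simps)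
  qed (use lipschitz_on_nonneg[OF lip] M in simp)
  \<comment> \<open>Keeping \<open>X y\<close> fixed while the centre moves gives a lower paraboloid
    for \<open>c\<close> that touches at \<open>y\<close> with this slope.\<close>
  have subgrad: "c y + (M *\<^sub>R (X y - y)) \<bullet> (z - y) \<le> c z" for y z
  proof (rule convex_on_affine_minorant[OF c_convex])
    fix w
    have "M / 2 * (norm (X y - w))\<^sup>2
        = M / 2 * (norm (X y - y))\<^sup>2 - (M *\<^sub>R (X y - y)) \<bullet> (w - y) + M / 2 * (norm (w - y))\<^sup>2"
      unfolding power2_norm_eq_inner by (simp add: inner_commute algebra_simps)
    then show "c y + (M *\<^sub>R (X y - y)) \<bullet> (w - y) - M / 2 * (norm (w - y))\<^sup>2 \<le> c w"
      using cF[of "X y" w] c_def[of y] by linarith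
  qed
  \<comment> \<open>Adding the subgradient inequalities at \<open>a\<close> and \<open>b\<close>
    shows that \<open>X\<close> minus the identity is monotone.\<close>
  have expanding: "norm (a - b) \<le> norm (X a - X b)" for a b
  proof -
    have "0 \<le> M * (((X a - a) - (X b - b)) \<bullet> (a - b))"
      using subgrad[of a b] subgrad[of b a] by (simp add: inner_simps algebra_simps)
    then have "0 \<le> ((X a - a) - (X b - b)) \<bullet> (a - b)"
      using M by (simp add: zero_le_mult_iff)
    then have "(a - b) \<bullet> (a - b) \<le> (X a - X b) \<bullet> (a - b)"
      by (simp add: algebra_simps)
    then have "norm (a - b) * norm (a - b) \<le> (X a - X b) \<bullet> (a - b)"
      by (simp only: dot_square_norm power2_eq_square)
    also have "\<dots> \<le> norm (X a - X b) * norm (a - b)" by (rule norm_cauchy_schwarz)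
    finally show ?thesis by (cases "a = b") auto
  qed
  show ?thesis
    by (rule that[OF g_convex g_C11 contact dist expanding])
qed

section \<open>Globally Lipschitz truncation\<close>

text \<open>\<open>F\<close> is the largest \<open>L\<close>-Lipschitz minorant of \<open>f\<close>,
  obtained by infimal convolution with \<open>L * norm\<close>. It agrees with \<open>f\<close> on
  the ball once \<open>L\<close> bounds the slopes of \<open>f\<close> seen from points
  there.\<close>

lemma convex_on_lipschitz_truncation:
  fixes f :: "'a::euclidean_space \<Rightarrow> real"
  assumes f: "convex_on UNIV f" and R: "R \<ge> 0"
  obtains F L where "convex_on UNIV F" "L-lipschitz_on UNIV F" "\<And>x. norm x \<le> R \<Longrightarrow> F x = f x"
proof -
  have cont: "continuous_on UNIV f" using f by (intro convex_on_continuous) auto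
  have "bounded (f ` cball 0 (R + 1))"
    by (intro compact_imp_bounded compact_continuous_image continuous_on_subset[OF cont]) auto
  then obtain B where B: "\<And>x. norm x \<le> R + 1 \<Longrightarrow> \<bar>f x\<bar> \<le> B" "B > 0"
    unfolding bounded_pos by (metis imageI mem_cball_0 real_norm_def)
  \<comment> \<open>Bounds the increment of \<open>f\<close> over a unit step starting in the ball
    of radius \<open>R\<close>.\<close>
  define L where "L = 2 * B"
  have L: "L \<ge> 0" using B by (simp add: L_def)
  \<comment> \<open>Here \<open>z\<close> is arbitrary: the segment from \<open>z\<close> to
    \<open>y\<close>, prolonged by unit length, ends in the ball of radius \<open>R + 1\<close>, and
    slopes of a convex function increase along a line.\<close>
  have slope: "f y - f z \<le> L * norm (y - z)" if y: "norm y \<le> R" for y z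
  proof (cases "y = z")
    case False
    define s where "s = norm (y - z)"
    have s: "s > 0" using False by (simp add: s_def)
    define v where "v = (1 / s) *\<^sub>R (y - z)"
    have nv: "norm v = 1" using s by (simp add: v_def s_def[symmetric])
    have yz: "y - z = s *\<^sub>R v" using s by (simp add: v_def)
    \<comment> \<open>This weight makes \<open>y\<close> the convex combination of \<open>z\<close>
      and \<open>y + v\<close>, which lie at distances \<open>s\<close> and \<open>1\<close> from
      it.\<close>
    define t where "t = s / (1 + s)"
    have t: "0 \<le> t" "t \<le> 1" "1 - t = 1 / (1 + s)" using s by (auto simp: t_def field_simps)
    have zy: "z = y - s *\<^sub>R v" using yz by (simp add: algebra_simps)
    have "(1 - t) *\<^sub>R z + t *\<^sub>R (y + v) = y + (t - (1 - t) * s) *\<^sub>R v"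
      unfolding zy by (simp add: algebra_simps)
    also have "t - (1 - t) * s = 0" unfolding t(3) by (simp add: t_def)
    finally have "(1 - t) *\<^sub>R z + t *\<^sub>R (y + v) = y" by simp
    then have "f y \<le> (1 - t) * f z + t * f (y + v)"
      using convex_onD[OF f t(1,2), of z "y + v"] by simp
    then have "(1 + s) * f y \<le> (1 + s) * ((1 - t) * f z + t * f (y + v))"
      using s by (intro mult_left_mono) auto
    also have "\<dots> = ((1 + s) * (1 - t)) * f z + ((1 + s) * t) * f (y + v)"
      by (simp add: algebra_simps)
    also have "(1 + s) * (1 - t) = 1" using s unfolding t(3) by simp
    also have "(1 + s) * t = s" using s by (simp add: t_def)
    finally have "(1 + s) * f y \<le> f z + s * f (y + v)" by simp
    then have "f y - f z \<le> s * (f (y + v) - f y)" by (simp add: algebra_simps)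
    also have "\<dots> \<le> s * L"
      using B(1)[of y] B(1)[of "y + v"] y nv norm_triangle_ineq[of y v] s
      by (intro mult_left_mono) (auto simp: L_def)
    finally show ?thesis by (simp add: s_def mult.commute)
  qed simp
  define F where "F y = (INF z. f z + L * norm (y - z))" for y
  have bdd: "bdd_below (range (\<lambda>z. f z + L * norm (y - z)))" for y
  proof (rule bdd_belowI2)
    fix z
    have "L * norm z \<le> L * (norm y + norm (y - z))"
      using norm_triangle_ineq4[of y "y - z"] L by (intro mult_left_mono) auto
    then show "f 0 - L * norm y \<le> f z + L * norm (y - z)"
      using slope[of 0 z] R by (simp add: algebra_simps)
  qed
  have le: "F y \<le> f z + L * norm (y - z)" for y z
    unfolding F_def by (rule cINF_lower[OF bdd]) simp
  have "convex_on UNIV (\<lambda>x::'a. L * norm x)"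
    using convex_on_cmul[OF L convex_on_dist[of UNIV "0::'a"]] by simp
  then have "convex_on UNIV F"
    unfolding F_def using bdd by (intro convex_on_infimal_convolution f)
  moreover have F_diff: "F a - F b \<le> L * norm (a - b)" for a b
  proof -
    have "F a - L * norm (a - b) \<le> F b"
      unfolding F_def[of b]
    proof (rule cINF_greatest)
      fix z
      have "L * norm (a - z) \<le> L * (norm (a - b) + norm (b - z))"
        using norm_triangle_ineq[of "a - b" "b - z"] L by (intro mult_left_mono) auto
      then show "F a - L * norm (a - b) \<le> f z + L * norm (b - z)"
        using le[of a z] by (simp add: algebra_simps)
    qed simp
    then show ?thesis by simp
  qed
  have "L-lipschitz_on UNIV F"
  proof (rule lipschitz_onI)
    fix a b show "dist (F a) (F b) \<le> L * dist a b"
      using F_diff[of a b] F_diff[of b a] by (simp add: dist_norm norm_minus_commute)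
  qed (rule L)
  moreover have "F x = f x" if "norm x \<le> R" for x
  proof (rule antisym)
    show "F x \<le> f x" using le[of x x] by simp
    show "f x \<le> F x" unfolding F_def
      using slope[OF that] by (intro cINF_greatest) (auto simp: algebra_simps)
  qed
  ultimately show ?thesis using that by blast
qed

section \<open>Approximation on balls and exhaustion\<close>

text \<open>The coincidence set within radius \<open>R + s\<close> has at least the volume of the
  ball of radius \<open>R\<close>, so the points of disagreement have at most the volume of the
  shell between the two balls.\<close>

lemma lusin_C11_cball:
  fixes f :: "'a::euclidean_space \<Rightarrow> real"
  assumes f: "convex_on UNIV f" and R: "R \<ge> 0" and e: "e > 0"
  obtains g where "convex_on UNIV g" "C11 g"
    "emeasure lebesgue {x \<in> cball 0 R. f x \<noteq> g x} < ennreal e"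
proof -
  obtain F L where F: "convex_on UNIV F" "L-lipschitz_on UNIV F" "\<And>x. norm x \<le> R \<Longrightarrow> F x = f x"
    by (rule convex_on_lipschitz_truncation[OF f R]) blast
  have L: "L \<ge> 0" using F(2) by (rule lipschitz_on_nonneg)
  define vol where "vol r = unit_ball_vol (DIM('a)) * r ^ DIM('a)" for r :: real
  have vol: "emeasure lebesgue (cball (0::'a) r) = ennreal (vol r)" if "r \<ge> 0" for r
    using that by (simp add: vol_def emeasure_cball)
  have "isCont vol R" unfolding vol_def by (intro continuous_intros)
  then obtain d where d: "d > 0" "\<And>r. \<bar>r - R\<bar> < d \<Longrightarrow> \<bar>vol r - vol R\<bar> < e"
    using e by (auto simp: continuous_at_eps_delta dist_real_def)
  define s where "s = d / 2"
  have s: "s > 0" "\<bar>vol (R + s) - vol R\<bar> < e" using d by (auto simp: s_def)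
  \<comment> \<open>Makes the displacement \<open>2 * L / M\<close> at most \<open>s\<close>; the
    summand \<open>1\<close> keeps \<open>M\<close> positive when \<open>L = 0\<close>.\<close>
  define M where "M = (2 * L + 1) / s"
  have M: "M > 0" using L s by (simp add: M_def add_nonneg_pos)
  have Ms: "2 * L / M \<le> s" using L s by (simp add: M_def field_simps)
  obtain g X where g: "convex_on UNIV g" "C11 g" "\<And>y. g (X y) = F (X y)"
    "\<And>y. norm (X y - y) \<le> 2 * L / M" "\<And>a b. norm (a - b) \<le> norm (X a - X b)"
    by (rule lasry_lions_regularization[OF F(1,2) M]) blast
  define G where "G = {x \<in> cball 0 (R + s). F x = g x}"
  have cont: "continuous_on UNIV F" "continuous_on UNIV g"
    using F(1) g(1) by (auto intro: convex_on_continuous)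
  have "closed {x. F x = g x}" by (intro closed_Collect_eq cont)
  then have "closed (cball 0 (R + s) \<inter> {x. F x = g x})" by (intro closed_Int) auto
  then have "closed G" by (simp only: G_def Collect_conj_eq Collect_mem_eq)
  then have G: "G \<in> sets lebesgue" by simp
  have inj: "inj X"
    using g(5) by (metis (no_types) eq_iff_diff_eq_0 injI norm_le_zero_iff norm_zero)
  \<comment> \<open>The inverse of the expanding map \<open>X\<close> is nonexpansive on the image
    of the ball, which lies in \<open>G\<close>.\<close>
  have "emeasure lebesgue (cball (0::'a) R) \<le> emeasure lebesgue G"
  proof (rule emeasure_le_of_nonexpansive_image)
    show "1-lipschitz_on (X ` cball 0 R) (inv X)"
      using g(5) inj by (intro lipschitz_onI) (auto simp: dist_norm)
    show "X ` cball 0 R \<subseteq> G"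
    proof (rule image_subsetI)
      fix y :: 'a assume y: "y \<in> cball 0 R"
      have "norm (X y) \<le> norm y + norm (X y - y)"
        using norm_triangle_ineq[of y "X y - y"] by simp
      then show "X y \<in> G" using y g(3)[of y] g(4)[of y] Ms by (simp add: G_def)
    qed
    show "cball 0 R \<subseteq> inv X ` X ` cball 0 R" using inj by (simp add: image_image)
  qed (rule G)
  then have RG: "ennreal (vol R) \<le> emeasure lebesgue G" using vol R by simp
  have "emeasure lebesgue {x \<in> cball 0 R. f x \<noteq> g x} \<le> emeasure lebesgue (cball 0 (R + s) - G)"
    using G F(3) s by (intro emeasure_mono) (auto simp: G_def)
  also have "\<dots> = emeasure lebesgue (cball (0::'a) (R + s)) - emeasure lebesgue G"
  proof (rule emeasure_Diff)
    have "emeasure lebesgue G \<le> emeasure lebesgue (cball (0::'a) (R + s))"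
      by (intro emeasure_mono) (auto simp: G_def)
    then show "emeasure lebesgue G \<noteq> \<infinity>" using vol[of "R + s"] R s by (auto simp: top_unique)
  qed (use G in \<open>auto simp: G_def\<close>)
  also have "\<dots> \<le> ennreal (vol (R + s)) - ennreal (vol R)"
    using RG vol[of "R + s"] R s by (auto intro: ennreal_minus_mono)
  also have "\<dots> = ennreal (vol (R + s) - vol R)"
    using R by (intro ennreal_minus) (simp add: vol_def)
  also have "\<dots> < ennreal e" using s e by (intro ennreal_lessI) auto
  finally show ?thesis using that g by blast
qed

theorem theorem1p3:
  fixes f :: "real ^ 'n \<Rightarrow> real"
    and A :: "(real ^ 'n) set"
    and \<epsilon> :: real
  assumes "convex_on UNIV f"
    and "A \<in> sets lebesgue"
    and "emeasure lebesgue A < \<infinity>"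
    and "\<epsilon> > 0"
  shows "\<exists>g :: real ^ 'n \<Rightarrow> real. convex_on UNIV g \<and> C11 g \<and>
           emeasure lebesgue {x \<in> A. f x \<noteq> g x} < ennreal \<epsilon>"
proof -
  \<comment> \<open>As \<open>A\<close> has finite measure, these tails, decreasing to the empty
    set, vanish in measure. Half of \<open>\<epsilon>\<close> is spent on a tail and half on the
    ball.\<close>
  define T where "T k = A - cball 0 (real k)" for k
  have "(\<lambda>k. emeasure lebesgue (T k)) \<longlonglongrightarrow> emeasure lebesgue (\<Inter>k. T k)"
  proof (rule Lim_emeasure_decseq)
    show "range T \<subseteq> sets lebesgue" using assms by (auto simp: T_def)
    show "decseq T" by (auto simp: T_def decseq_def)
    show "emeasure lebesgue (T k) \<noteq> \<infinity>" for k
      using assms emeasure_mono[of "T k" A lebesgue] by (auto simp: T_def top_unique)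
  qed
  moreover have "(\<Inter>k. T k) = {}"
    by (auto simp: T_def) (meson linorder_not_less order.strict_iff_order real_arch_simple)
  ultimately have "\<forall>\<^sub>F k in sequentially. emeasure lebesgue (T k) < ennreal (\<epsilon> / 2)"
    using assms(4) by (intro order_tendstoD(2)[of _ 0]) auto
  then obtain k where k: "emeasure lebesgue (T k) < ennreal (\<epsilon> / 2)"
    by (auto simp: eventually_sequentially)
  obtain g where g: "convex_on UNIV g" "C11 g"
    "emeasure lebesgue {x \<in> cball 0 (real k). f x \<noteq> g x} < ennreal (\<epsilon> / 2)"
    using lusin_C11_cball[OF assms(1), of "real k" "\<epsilon> / 2"] assms(4) by auto
  have "closed {x. f x = g x}"
    using assms(1) g(1) by (intro closed_Collect_eq convex_on_continuous) auto
  then have "{x. f x \<noteq> g x} \<in> sets lebesgue"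
    by (simp add: closed_def Collect_neg_eq[symmetric])
  then have meas: "{x \<in> cball 0 (real k). f x \<noteq> g x} \<in> sets lebesgue"
    unfolding Collect_conj_eq by (intro sets.Int) auto
  have "emeasure lebesgue {x \<in> A. f x \<noteq> g x}
      \<le> emeasure lebesgue ({x \<in> cball 0 (real k). f x \<noteq> g x} \<union> T k)"
    using meas assms(2) by (intro emeasure_mono sets.Un) (auto simp: T_def)
  also have "\<dots> \<le> emeasure lebesgue {x \<in> cball 0 (real k). f x \<noteq> g x} + emeasure lebesgue (T k)"
    using meas assms(2) by (intro emeasure_subadditive) (auto simp: T_def)
  also have "\<dots> < ennreal (\<epsilon> / 2) + ennreal (\<epsilon> / 2)"
    by (rule add_strict_mono[OF g(3) k])
  also have "\<dots> = ennreal \<epsilon>"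
    using assms(4) by (simp flip: ennreal_plus)
  finally show ?thesis using g by blast
qed

end
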